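(* Let $n\geq 1$. Let $\mathcal{C}$ be the class of all expansions $(\mathbb{R}^n,\beta,P)$ of $(\mathbb{R}^n,\beta)$ by a unary predicate $P\subseteq\mathbb{R}^n$, and let $\mathcal{F}\subseteq\mathcal{C}$ be the subclass of those expansions in which $P$ is finite. Then $\mathcal{F}$ is first-order definable with respect to $\mathcal{C}$, i.e., there is a first-order sentence $\varphi$ of vocabulary $\{\beta,P\}$ such that for every $\mathfrak{M}\in\mathcal{C}$, $\mathfrak{M}\in\mathcal{F}$ iff $\mathfrak{M}\models\varphi$.
   Context: $\beta$ is the Euclidean betweenness relation on $\mathbb{R}^n$: $\beta(s,t,u)$ iff $d(s,u)=d(s,t)+d(t,u)$, where $d$ is the Euclidean metric. *)

theory Defs
  imports "HOL-Analysis.Analysis"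
begin

text \<open>
  First-order formulas with equality over a ternary relation symbol \<beta> and a unary
  relation symbol \<open>P\<close>. Variables are named by natural numbers; the remaining connectives and
  the universal quantifier are expressible by the usual abbreviations.
\<close>

datatype fm =
    Eq nat nat
  | Beta nat nat nat
  | Pred nat
  | Neg fm
  | Conj fm fm
  | Exists nat fm

primrec free_vars :: "fm \<Rightarrow> nat set" where
  "free_vars (Eq x y) = {x, y}"
| "free_vars (Beta x y z) = {x, y, z}"
| "free_vars (Pred x) = {x}"
| "free_vars (Neg \<phi>) = free_vars \<phi>"
| "free_vars (Conj \<phi> \<psi>) = free_vars \<phi> \<union> free_vars \<psi>"
| "free_vars (Exists x \<phi>) = free_vars \<phi> - {x}"

definition is_sentence :: "fm \<Rightarrow> bool" where
  "is_sentence \<phi> \<longleftrightarrow> free_vars \<phi> = {}"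

text \<open>The domain of a structure is the whole type \<^typ>\<open>'a\<close>.\<close>

record 'a struct =
  beta :: "'a \<Rightarrow> 'a \<Rightarrow> 'a \<Rightarrow> bool"
  pred :: "'a set"

primrec sat :: "'a struct \<Rightarrow> (nat \<Rightarrow> 'a) \<Rightarrow> fm \<Rightarrow> bool" where
  "sat M e (Eq x y) \<longleftrightarrow> e x = e y"
| "sat M e (Beta x y z) \<longleftrightarrow> beta M (e x) (e y) (e z)"
| "sat M e (Pred x) \<longleftrightarrow> e x \<in> pred M"
| "sat M e (Neg \<phi>) \<longleftrightarrow> \<not> sat M e \<phi>"
| "sat M e (Conj \<phi> \<psi>) \<longleftrightarrow> sat M e \<phi> \<and> sat M e \<psi>"
| "sat M e (Exists x \<phi>) \<longleftrightarrow> (\<exists>a. sat M (e(x := a)) \<phi>)"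

definition models :: "'a struct \<Rightarrow> fm \<Rightarrow> bool" where
  "models M \<phi> \<longleftrightarrow> (\<forall>e. sat M e \<phi>)"

definition fo_definable_wrt :: "'a struct set \<Rightarrow> 'a struct set \<Rightarrow> bool" where
  "fo_definable_wrt K C \<longleftrightarrow> (\<exists>\<phi>. is_sentence \<phi> \<and> (\<forall>M\<in>C. M \<in> K \<longleftrightarrow> models M \<phi>))"

definition euclidean_between :: "real ^ 'n \<Rightarrow> real ^ 'n \<Rightarrow> real ^ 'n \<Rightarrow> bool" where
  "euclidean_between s t u \<longleftrightarrow> dist s u = dist s t + dist t u"

definition expansions :: "(real ^ 'n) struct set" where
  "expansions = {M. beta M = euclidean_between}"

definition finite_expansions :: "(real ^ 'n) struct set" where
  "finite_expansions = {M \<in> expansions. finite (pred M)}"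

end

theory Submission
  imports Defs
begin

text \<open>
  A set is finite iff it is bounded and has no limit point. Both conditions can be expressed by
  quantifying over polytopes with a fixed number \<open>N\<close> of vertices, where \<open>N\<close> is large enough for a
  cube to be such a polytope: membership in a convex hull is obtained by iterating betweenness,
  and a point lies in the interior of a convex set iff the set reaches out from that point in every
  direction.
\<close>

section \<open>Finiteness in terms of polytopes\<close>

text \<open>A ball around \<open>x\<close> contains an initial piece of every segment from
  \<open>x\<close>. Conversely, in finite dimension a point of a convex set is interior once the set
  extends from it some way in every direction. The right-hand side uses only betweenness and
  membership in \<open>S\<close>.\<close>

lemma interior_convex_iff_segments:
  fixes S :: "'a::euclidean_space set"
  assumes "convex S" "x \<in> S"
  shows "x \<in> interior S \<longleftrightarrow> (\<forall>y. y \<noteq> x \<longrightarrow> (\<exists>z. z \<noteq> x \<and> z \<in> S \<and> z \<in> closed_segment x y))"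
    (is "_ \<longleftrightarrow> ?R")
proof
  assume "x \<in> interior S"
  then obtain d where d: "d > 0" "ball x d \<subseteq> S"
    by (auto simp: mem_interior)
  show ?R
  proof (intro allI impI)
    fix y assume "y \<noteq> x"
    \<comment> \<open>The minimum with 1 keeps the point on the segment; the factor 2 keeps it
      strictly inside the open ball.\<close>
    define u where "u = min 1 (d / (2 * dist x y))"
    have u: "0 < u" "u \<le> 1"
      using d \<open>y \<noteq> x\<close> by (auto simp: u_def)
    have "u * dist x y \<le> d / 2"
      using \<open>y \<noteq> x\<close> by (auto simp: u_def min_def field_simps)
    then have "u * dist x y < d"
      using d by simp
    then have "x + u *\<^sub>R (y - x) \<in> ball x d"
      using u by (simp add: dist_norm norm_minus_commute)
    moreover have "x + u *\<^sub>R (y - x) \<noteq> x"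
      using u \<open>y \<noteq> x\<close> by simp
    moreover have "x + u *\<^sub>R (y - x) \<in> closed_segment x y"
      using u by (auto simp: closed_segment_def algebra_simps intro!: exI[of _ u])
    ultimately show "\<exists>z. z \<noteq> x \<and> z \<in> S \<and> z \<in> closed_segment x y"
      using d by blast
  qed
next
  assume R: ?R
  have "\<exists>e>0. x + e *\<^sub>R v \<in> S" for v
  proof (cases "v = 0")
    case True
    then show ?thesis
      using assms by (auto intro!: exI[of _ 1])
  next
    case False
    then obtain z where z: "z \<noteq> x" "z \<in> S" "z \<in> closed_segment x (x + v)"
      using R[rule_format, of "x + v"] by auto
    then obtain u where u: "0 \<le> u" "z = x + u *\<^sub>R v"
      by (auto simp: closed_segment_def algebra_simps)
    \<comment> \<open>\<open>z \<noteq> x\<close> excludes \<open>u = 0\<close>.\<close>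
    then show ?thesis
      using z by (intro exI[of _ u]) (auto simp: order_less_le)
  qed
  then show "x \<in> interior S"
    using assms convex_interior_iff by blast
qed

text \<open>The cube with all coordinates in [-1,1] works: it is the hull of finitely many points,
  enumerated here from 1 so that the indices can serve as variable names.\<close>

lemma round_polytope_exists:
  obtains N :: nat and g :: "nat \<Rightarrow> 'a::euclidean_space" and K :: real
  where "K > 0" "ball 0 1 \<subseteq> convex hull (g ` {1..N})" "convex hull (g ` {1..N}) \<subseteq> ball 0 K"
proof -
  obtain S where S: "finite S" "cbox (- One) One = convex hull (S :: 'a set)"
    using closed_interval_as_convex_hull by blast
  obtain g where "bij_betw g {1..card S} S"
    using S(1) ex_bij_betw_nat_finite_1 by blast
  then have g: "g ` {1..card S} = S"
    by (simp add: bij_betw_def)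
  have "x \<in> cbox (- One) (One :: 'a)" if "norm x < 1" for x
  proof -
    have "\<bar>x \<bullet> b\<bar> \<le> 1" if "b \<in> Basis" for b
      using Basis_le_norm[OF that, of x] \<open>norm x < 1\<close> by linarith
    then show ?thesis
      by (force simp: mem_box)
  qed
  then have "ball 0 1 \<subseteq> convex hull (g ` {1..card S})"
    unfolding g S(2)[symmetric] by auto
  moreover obtain K where "K > 0" "convex hull (g ` {1..card S}) \<subseteq> ball 0 K"
    unfolding g S(2)[symmetric] using bounded_subset_ballD[OF bounded_cbox, of _ _ 0] by blast
  ultimately show ?thesis
    using that by blast
qed

text \<open>Scaling and translating one polytope gives all of these, so \<open>N\<close> and
  \<open>K\<close> do not depend on \<open>c\<close> and \<open>r\<close>.\<close>

lemma small_and_large_polytopes_exist: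
  obtains N :: nat and K :: real
  where "K > 0"
    "\<And>c r. r > 0 \<Longrightarrow> \<exists>f :: nat \<Rightarrow> 'a::euclidean_space.
      ball c r \<subseteq> convex hull (insert c (f ` {1..N})) \<and>
      convex hull (insert c (f ` {1..N})) \<subseteq> ball c (r * K)"
proof -
  obtain N and g :: "nat \<Rightarrow> 'a" and K :: real
    where K: "K > 0" and g: "ball 0 1 \<subseteq> convex hull (g ` {1..N})"
      "convex hull (g ` {1..N}) \<subseteq> ball 0 K"
    by (rule round_polytope_exists)
  have "\<exists>f. ball c r \<subseteq> convex hull (insert c (f ` {1..N})) \<and>
      convex hull (insert c (f ` {1..N})) \<subseteq> ball c (r * K)" if "r > 0" for c :: 'a and r
  proof -
    define T where "T = (\<lambda>x :: 'a. c + r *\<^sub>R x)"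
    have hull: "convex hull ((T \<circ> g) ` {1..N}) = T ` (convex hull (g ` {1..N}))"
      unfolding T_def image_comp[symmetric] by (rule convex_hull_affinity)
    have T_ball: "T ` ball 0 s = ball c (r * s)" for s
    proof -
      have "T ` ball 0 s = (+) c ` (*\<^sub>R) r ` ball 0 s"
        by (simp add: T_def image_comp o_def)
      also have "\<dots> = ball c (r * s)"
        using \<open>r > 0\<close> by (simp add: ball_scale ball_translation[symmetric])
      finally show ?thesis .
    qed
    have inner: "ball c r \<subseteq> convex hull ((T \<circ> g) ` {1..N})"
      using image_mono[OF g(1), of T] unfolding hull T_ball by simp
    have outer: "convex hull ((T \<circ> g) ` {1..N}) \<subseteq> ball c (r * K)"
      using image_mono[OF g(2), of T] unfolding hull T_ball .
    \<comment> \<open>\<open>c\<close> is the centre of the inscribed ball, so it already lies in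
      the hull.\<close>
    have "convex hull (insert c ((T \<circ> g) ` {1..N})) = convex hull ((T \<circ> g) ` {1..N})"
      using inner \<open>r > 0\<close> by (intro hull_redundant) auto
    then show ?thesis
      using inner outer by metis
  qed
  with K show ?thesis
    using that by blast
qed

text \<open>The first condition says that \<open>A\<close> is bounded, the second that it has no
  limit point; Bolzano-Weierstrass then gives finiteness. The point \<open>c\<close> occurs in both,
  so that they share one quantifier prefix.\<close>

lemma finite_iff_polytopes:
  obtains N :: nat where
    "\<And>A :: 'a::euclidean_space set. finite A \<longleftrightarrow>
      (\<forall>c. \<exists>f. A \<subseteq> convex hull (insert c (f ` {1..N}))) \<and>
      (\<forall>c. \<exists>f. c \<in> interior (convex hull (insert c (f ` {1..N}))) \<and>
        A \<inter> convex hull (insert c (f ` {1..N})) \<subseteq> {c})"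
proof -
  obtain N :: nat and K :: real where K: "K > 0" and
    poly: "\<And>c r. r > 0 \<Longrightarrow> \<exists>f :: nat \<Rightarrow> 'a.
      ball c r \<subseteq> convex hull (insert c (f ` {1..N})) \<and>
      convex hull (insert c (f ` {1..N})) \<subseteq> ball c (r * K)"
    using small_and_large_polytopes_exist by metis
  have bdd: "\<exists>f. A \<subseteq> convex hull (insert c (f ` {1..N}))" if "finite A" for A and c :: 'a
  proof -
    obtain r where "r > 0" "A \<subseteq> ball c r"
      using bounded_subset_ballD finite_imp_bounded \<open>finite A\<close> by blast
    then show ?thesis
      using poly by (meson subset_trans)
  qed
  have isol: "\<exists>f. c \<in> interior (convex hull (insert c (f ` {1..N}))) \<and>
      A \<inter> convex hull (insert c (f ` {1..N})) \<subseteq> {c}" if "finite A" for A and c :: 'a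
  proof -
    obtain d where d: "d > 0" "\<forall>x\<in>A. x \<noteq> c \<longrightarrow> d \<le> dist c x"
      using finite_set_avoid[OF \<open>finite A\<close>] by blast
    \<comment> \<open>At scale \<open>d / K\<close> the polytope fits into the open ball of radius
      \<open>d\<close>, which meets \<open>A\<close> at most in \<open>c\<close>.\<close>
    with K have "d / K > 0"
      by simp
    from poly[OF this] obtain f where f: "ball c (d / K) \<subseteq> convex hull (insert c (f ` {1..N}))"
      "convex hull (insert c (f ` {1..N})) \<subseteq> ball c (d / K * K)"
      by blast
    have "c \<in> interior (convex hull (insert c (f ` {1..N})))"
      using f(1) \<open>d / K > 0\<close> mem_interior by blast
    moreover have "A \<inter> convex hull (insert c (f ` {1..N})) \<subseteq> {c}"
      using f(2) d K by force
    ultimately show ?thesis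
      by blast
  qed
  have fin: "finite A"
    if bdd: "\<forall>c. \<exists>f. A \<subseteq> convex hull (insert c (f ` {1..N}))"
      and isol: "\<forall>c. \<exists>f. c \<in> interior (convex hull (insert c (f ` {1..N}))) \<and>
        A \<inter> convex hull (insert c (f ` {1..N})) \<subseteq> {c}" for A :: "'a set"
  proof (rule ccontr)
    assume "infinite A"
    obtain f where "A \<subseteq> convex hull (insert 0 (f ` {1..N}))"
      using bdd by blast
    then have "bounded A"
      by (rule bounded_subset[rotated]) (simp add: bounded_convex_hull finite_imp_bounded)
    then obtain c where c: "c islimpt A"
      using \<open>infinite A\<close> bounded_infinite_imp_islimpt by blast
    obtain f where f: "c \<in> interior (convex hull (insert c (f ` {1..N})))"
      "A \<inter> convex hull (insert c (f ` {1..N})) \<subseteq> {c}"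
      using isol by blast
    \<comment> \<open>The interior of the polytope is an open neighbourhood of the limit point
      \<open>c\<close>.\<close>
    obtain y where "y \<in> A" "y \<in> interior (convex hull (insert c (f ` {1..N})))" "y \<noteq> c"
      using islimptE[OF c f(1) open_interior] by blast
    then show False
      using f(2) interior_subset by blast
  qed
  show ?thesis
    by (rule that[of N], intro iffI conjI allI; (elim conjE)?) (fact bdd isol fin)+
qed

section \<open>The defining sentence\<close>

definition Forall :: "nat \<Rightarrow> fm \<Rightarrow> fm" where
  "Forall x \<phi> = Neg (Exists x (Neg \<phi>))"

definition Imp :: "fm \<Rightarrow> fm \<Rightarrow> fm" where
  "Imp \<phi> \<psi> = Neg (Conj \<phi> (Neg \<psi>))"

lemma sat_Forall [simp]: "sat M e (Forall x \<phi>) \<longleftrightarrow> (\<forall>a. sat M (e(x := a)) \<phi>)"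
  by (simp add: Forall_def)

lemma sat_Imp [simp]: "sat M e (Imp \<phi> \<psi>) \<longleftrightarrow> (sat M e \<phi> \<longrightarrow> sat M e \<psi>)"
  by (simp add: Imp_def)

lemma free_vars_Forall [simp]: "free_vars (Forall x \<phi>) = free_vars \<phi> - {x}"
  by (simp add: Forall_def)

lemma free_vars_Imp [simp]: "free_vars (Imp \<phi> \<psi>) = free_vars \<phi> \<union> free_vars \<psi>"
  by (simp add: Imp_def)

text \<open>Numbering starts at 1 because variable 0 is reserved for the point
  \<open>c\<close>.\<close>

primrec Exists_upto :: "nat \<Rightarrow> fm \<Rightarrow> fm" where
  "Exists_upto 0 \<phi> = \<phi>"
| "Exists_upto (Suc k) \<phi> = Exists_upto k (Exists (Suc k) \<phi>)"

lemma sat_Exists_upto: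
  "sat M e (Exists_upto k \<phi>) \<longleftrightarrow> (\<exists>f. sat M (\<lambda>i. if i \<in> {1..k} then f i else e i) \<phi>)"
proof (induction k arbitrary: \<phi>)
  case 0
  then show ?case by simp
next
  case (Suc k)
  have upd: "(\<lambda>i. if i \<in> {1..k} then f i else e i)(Suc k := a) =
      (\<lambda>i. if i \<in> {1..Suc k} then (f(Suc k := a)) i else e i)" for f a
    by (auto simp: fun_eq_iff)
  \<comment> \<open>Every function is its own update at \<open>Suc k\<close>, so the two quantifiers
    merge into one.\<close>
  have "(\<exists>f a. Q (f(Suc k := a))) \<longleftrightarrow> (\<exists>f. Q f)" for Q :: "(nat \<Rightarrow> 'a) \<Rightarrow> bool"
    by (metis fun_upd_triv[of _ "Suc k"])
  from this[of "\<lambda>f. sat M (\<lambda>i. if i \<in> {1..Suc k} then f i else e i) \<phi>"] show ?case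
    by (simp only: Exists_upto.simps Suc.IH sat.simps upd)
qed

lemma free_vars_Exists_upto: "free_vars (Exists_upto k \<phi>) = free_vars \<phi> - {1..k}"
  by (induction k arbitrary: \<phi>) (auto simp: le_Suc_eq)

text \<open>
  Variable \<open>v\<close> lies in the convex hull of variables \<open>0, \<dots>, k\<close>. The bound variables are
  \<open>v + 1, \<dots>, v + k\<close>, so \<open>k < v\<close> is needed to prevent capture.
\<close>

primrec In_hull :: "nat \<Rightarrow> nat \<Rightarrow> fm" where
  "In_hull 0 v = Eq v 0"
| "In_hull (Suc k) v = Exists (Suc v) (Conj (In_hull k (Suc v)) (Beta (Suc k) v (Suc v)))"

lemma free_vars_In_hull: "free_vars (In_hull k v) \<subseteq> insert v {0..k}"
  by (induction k arbitrary: v) fastforce+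

lemma euclidean_between_iff_closed_segment:
  "euclidean_between s t u \<longleftrightarrow> t \<in> closed_segment s u"
  using between[of s u t] by (simp add: euclidean_between_def between_mem_segment)

text \<open>Adding a point to a nonempty set makes its hull the union of the segments from that
  point to the old hull. The induction is over all \<open>v\<close> and \<open>e\<close>, since the
  recursion moves on to the auxiliary point \<open>Suc v\<close>.\<close>

lemma sat_In_hull:
  assumes "beta M = euclidean_between" "k < v"
  shows "sat M e (In_hull k v) \<longleftrightarrow> e v \<in> convex hull (e ` {0..k})"
  using assms(2)
proof (induction k arbitrary: v e)
  case 0
  then show ?case by simp
next
  case (Suc k)
  \<comment> \<open>The bound variable is larger than every vertex index, so no vertex is
    overwritten.\<close>
  have img: "e(Suc v := a) ` {0..k} = e ` {0..k}" for a
    using Suc.prems by (intro image_cong) auto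
  have "sat M e (In_hull (Suc k) v) \<longleftrightarrow>
      (\<exists>a \<in> convex hull (e ` {0..k}). e v \<in> closed_segment (e (Suc k)) a)"
    using Suc.prems assms(1)
    by (auto simp: Suc.IH img euclidean_between_iff_closed_segment)
  also have "\<dots> \<longleftrightarrow> e v \<in> convex hull (insert (e (Suc k)) (e ` {0..k}))"
    by (simp add: convex_hull_insert_segments)
  also have "insert (e (Suc k)) (e ` {0..k}) = e ` {0..Suc k}"
    by (simp add: atLeast0_atMost_Suc)
  finally show ?case .
qed

section \<open>Formulas for boundedness and isolation\<close>

definition Bounded_fm :: "nat \<Rightarrow> fm" where
  "Bounded_fm N = Forall 0 (Exists_upto N
    (Forall (N + 1) (Imp (Pred (N + 1)) (In_hull N (N + 1)))))"

text \<open>This encodes the segment criterion for variable 0: \<open>N + 1\<close> gives the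
  direction and \<open>N + 2\<close> the point reached. The variables bound by
  \<open>In_hull N (N + 2)\<close> start at \<open>N + 3\<close>.\<close>

definition Interior_fm :: "nat \<Rightarrow> fm" where
  "Interior_fm N = Forall (N + 1) (Imp (Neg (Eq (N + 1) 0))
    (Exists (N + 2) (Conj (Neg (Eq (N + 2) 0))
      (Conj (In_hull N (N + 2)) (Beta 0 (N + 2) (N + 1))))))"

definition Isolated_fm :: "nat \<Rightarrow> fm" where
  "Isolated_fm N = Forall 0 (Exists_upto N (Conj (Interior_fm N)
    (Forall (N + 1) (Imp (Conj (Pred (N + 1)) (In_hull N (N + 1))) (Eq (N + 1) 0)))))"

lemma image_updated_assignment:
  "(\<lambda>i. if i \<in> {1..N} then f i else (e(0 := c)) i) ` {0..N} = insert c (f ` {1..N :: nat})"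
proof -
  have "(\<lambda>i. if i \<in> {1..N} then f i else (e(0 := c)) i) ` {1..N} = f ` {1..N}"
    by (intro image_cong) auto
  moreover have "{0..N} = insert 0 {1..N}"
    by auto
  ultimately show ?thesis
    by (simp only: image_insert) simp
qed

lemma image_fresh_update: "v > N \<Longrightarrow> (e(v := a)) ` {0..N} = e ` {0..N :: nat}"
  by (intro image_cong) auto

lemma sat_Interior_fm:
  assumes "beta M = euclidean_between"
  shows "sat M e (Interior_fm N) \<longleftrightarrow> e 0 \<in> interior (convex hull (e ` {0..N}))"
proof -
  \<comment> \<open>Variable 0 is itself a vertex, as the criterion requires a point of the convex
    set.\<close>
  have "e 0 \<in> convex hull (e ` {0..N})"
    by (simp add: hull_inc)
  note interior = interior_convex_iff_segments[OF convex_convex_hull this]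
  show ?thesis
    unfolding interior using assms
    by (simp add: Interior_fm_def sat_In_hull image_fresh_update
        euclidean_between_iff_closed_segment)
qed

lemma sat_Bounded_fm:
  assumes "beta M = euclidean_between"
  shows "sat M e (Bounded_fm N) \<longleftrightarrow>
    (\<forall>c. \<exists>f. pred M \<subseteq> convex hull (insert c (f ` {1..N})))"
proof -
  have "sat M e' (Forall (N + 1) (Imp (Pred (N + 1)) (In_hull N (N + 1)))) \<longleftrightarrow>
      pred M \<subseteq> convex hull (e' ` {0..N})" for e'
    using assms by (auto simp: sat_In_hull image_fresh_update)
  then show ?thesis
    \<comment> \<open>Only the quantifier over variable 0 is unfolded, so the inner one still
      matches the equivalence above.\<close>
    by (simp only: Bounded_fm_def sat_Forall[of _ _ 0] sat_Exists_upto image_updated_assignment)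
qed

lemma sat_Isolated_fm:
  assumes "beta M = euclidean_between"
  shows "sat M e (Isolated_fm N) \<longleftrightarrow>
    (\<forall>c. \<exists>f. c \<in> interior (convex hull (insert c (f ` {1..N}))) \<and>
      pred M \<inter> convex hull (insert c (f ` {1..N})) \<subseteq> {c})"
proof -
  have "sat M e' (Forall (N + 1) (Imp (Conj (Pred (N + 1)) (In_hull N (N + 1))) (Eq (N + 1) 0))) \<longleftrightarrow>
      pred M \<inter> convex hull (e' ` {0..N}) \<subseteq> {e' 0}" for e'
    using assms by (auto simp: sat_In_hull image_fresh_update)
  then show ?thesis
    using assms
    by (simp only: Isolated_fm_def sat_Forall[of _ _ 0] sat_Exists_upto sat.simps sat_Interior_fm
        image_updated_assignment) simp
qed

theorem theorem5:
  "fo_definable_wrt (finite_expansions :: (real ^ 'n) struct set) expansions"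
proof -
  \<comment> \<open>\<open>N\<close> is fixed before \<open>A\<close>, so a single sentence serves
    all expansions.\<close>
  obtain N :: nat where N: "\<And>A :: (real ^ 'n) set. finite A \<longleftrightarrow>
      (\<forall>c. \<exists>f. A \<subseteq> convex hull (insert c (f ` {1..N}))) \<and>
      (\<forall>c. \<exists>f. c \<in> interior (convex hull (insert c (f ` {1..N}))) \<and>
        A \<inter> convex hull (insert c (f ` {1..N})) \<subseteq> {c})"
    by (fact finite_iff_polytopes)
  let ?\<phi> = "Conj (Bounded_fm N) (Isolated_fm N)"
  \<comment> \<open>Besides \<open>v\<close>, only the vertices 0 to \<open>N\<close> can be free,
    and the outer quantifiers bind those.\<close>
  have "x = v" if "x \<in> free_vars (In_hull N v)" "\<not> x \<le> N" for x v
    using free_vars_In_hull[of N v] that by auto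
  then have "is_sentence ?\<phi>"
    by (auto simp: is_sentence_def Bounded_fm_def Isolated_fm_def Interior_fm_def
        free_vars_Exists_upto)
  moreover have "M \<in> finite_expansions \<longleftrightarrow> models M ?\<phi>" if "M \<in> expansions"
    for M :: "(real ^ 'n) struct"
    using that N[of "pred M"]
    by (simp add: finite_expansions_def expansions_def models_def sat_Bounded_fm sat_Isolated_fm)
  ultimately show ?thesis
    unfolding fo_definable_wrt_def by blast
qed

end
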